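(* Let $\Omega \subset \mathbb{R}^d$ be a bounded and connected domain, and let $A : L^2(\Omega) \to L^2(\Omega)$ be a bounded linear operator that is stable, i.e., there exists a constant $\gamma > 0$ such that $$\|u\|_{L^2} \leq \gamma \|Au\|_{L^2} \quad \text{for all } u \in L^2(\Omega).$$ Let $f \in L^2(\Omega)$, let $u_* \in L^2(\Omega)$ be the exact solution to $A u_* = f$, and let $u_{NN} \in L^2(\Omega)$ be an approximation of $u_*$ (given by a neural network). Then, with the same constant $\gamma$, $$\|u_* - u_{NN}\|_{L^2} \leq \gamma \|A u_{NN} - f\|_{L^2}.$$
   Context: $\|\cdot\|_{L^2}$ denotes the norm of $L^2(\Omega)$. The function $u_{NN}$ is the neural network approximation of the solution of $Au = f$; no particular architecture, training procedure or approximation quality is assumed, so $u_{NN}$ is an arbitrary element of $L^2(\Omega)$ realized by a neural network. *)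

theory Defs
  imports "HOL-Analysis.Analysis"
begin

text \<open>
  The real space \<open>L\<^sup>2(\<Omega>)\<close> is the set of classes, modulo equality almost everywhere, of
  Lebesgue measurable functions on \<open>\<Omega>\<close> whose square is integrable. Representatives are total
  functions; their values outside \<open>\<Omega>\<close> are irrelevant.
\<close>

definition L2_fun :: "(real ^ 'd) set \<Rightarrow> (real ^ 'd \<Rightarrow> real) set" where
  "L2_fun \<Omega> = {u \<in> borel_measurable (lebesgue_on \<Omega>).
     integrable (lebesgue_on \<Omega>) (\<lambda>x. (u x)\<^sup>2)}"

definition ae_rel :: "(real ^ 'd) set \<Rightarrow> ((real ^ 'd \<Rightarrow> real) \<times> (real ^ 'd \<Rightarrow> real)) set" where
  "ae_rel \<Omega> = {(u, v). u \<in> L2_fun \<Omega> \<and> v \<in> L2_fun \<Omega> \<and> (AE x in lebesgue_on \<Omega>. u x = v x)}"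

definition L2 :: "(real ^ 'd) set \<Rightarrow> (real ^ 'd \<Rightarrow> real) set set" where
  "L2 \<Omega> = L2_fun \<Omega> // ae_rel \<Omega>"

definition L2_class :: "(real ^ 'd) set \<Rightarrow> (real ^ 'd \<Rightarrow> real) \<Rightarrow> (real ^ 'd \<Rightarrow> real) set" where
  "L2_class \<Omega> u = ae_rel \<Omega> `` {u}"

text \<open>
  The operations are computed on representatives; every choice of representatives gives the same
  result, so that the unions are over a single set (see the lemmas below).
\<close>

definition L2_add ::
    "(real ^ 'd) set \<Rightarrow> (real ^ 'd \<Rightarrow> real) set \<Rightarrow> (real ^ 'd \<Rightarrow> real) set \<Rightarrow> (real ^ 'd \<Rightarrow> real) set" where
  "L2_add \<Omega> U V = (\<Union>u\<in>U. \<Union>v\<in>V. L2_class \<Omega> (\<lambda>x. u x + v x))"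

definition L2_diff ::
    "(real ^ 'd) set \<Rightarrow> (real ^ 'd \<Rightarrow> real) set \<Rightarrow> (real ^ 'd \<Rightarrow> real) set \<Rightarrow> (real ^ 'd \<Rightarrow> real) set" where
  "L2_diff \<Omega> U V = (\<Union>u\<in>U. \<Union>v\<in>V. L2_class \<Omega> (\<lambda>x. u x - v x))"

definition L2_scale ::
    "(real ^ 'd) set \<Rightarrow> real \<Rightarrow> (real ^ 'd \<Rightarrow> real) set \<Rightarrow> (real ^ 'd \<Rightarrow> real) set" where
  "L2_scale \<Omega> c U = (\<Union>u\<in>U. L2_class \<Omega> (\<lambda>x. c * u x))"

definition L2_norm :: "(real ^ 'd) set \<Rightarrow> (real ^ 'd \<Rightarrow> real) set \<Rightarrow> real" where
  "L2_norm \<Omega> U = the_elem ((\<lambda>u. sqrt (LINT x|lebesgue_on \<Omega>. (u x)\<^sup>2)) ` U)"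

definition L2_bounded_linear ::
    "(real ^ 'd) set \<Rightarrow> ((real ^ 'd \<Rightarrow> real) set \<Rightarrow> (real ^ 'd \<Rightarrow> real) set) \<Rightarrow> bool" where
  "L2_bounded_linear \<Omega> A \<longleftrightarrow>
     (\<forall>u\<in>L2 \<Omega>. A u \<in> L2 \<Omega>) \<and>
     (\<forall>u\<in>L2 \<Omega>. \<forall>v\<in>L2 \<Omega>. A (L2_add \<Omega> u v) = L2_add \<Omega> (A u) (A v)) \<and>
     (\<forall>c. \<forall>u\<in>L2 \<Omega>. A (L2_scale \<Omega> c u) = L2_scale \<Omega> c (A u)) \<and>
     (\<exists>C. \<forall>u\<in>L2 \<Omega>. L2_norm \<Omega> (A u) \<le> C * L2_norm \<Omega> u)"

lemma equiv_ae_rel: "equiv (L2_fun \<Omega>) (ae_rel \<Omega>)"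
proof (rule equivI)
  show "ae_rel \<Omega> \<subseteq> L2_fun \<Omega> \<times> L2_fun \<Omega>" by (auto simp: ae_rel_def)
  show "refl_on (L2_fun \<Omega>) (ae_rel \<Omega>)" by (auto simp: refl_on_def ae_rel_def)
  show "sym (ae_rel \<Omega>)" by (auto simp: sym_def ae_rel_def elim: eventually_mono)
  show "trans (ae_rel \<Omega>)"
    by (auto simp: trans_def ae_rel_def elim: eventually_elim2)
qed

lemma L2_fun_scale:
  assumes "u \<in> L2_fun \<Omega>" shows "(\<lambda>x. c * u x) \<in> L2_fun \<Omega>"
  using assms by (auto simp: L2_fun_def power_mult_distrib)

lemma L2_fun_add:
  assumes "u \<in> L2_fun \<Omega>" "v \<in> L2_fun \<Omega>" shows "(\<lambda>x. u x + v x) \<in> L2_fun \<Omega>"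
proof -
  have [measurable]: "u \<in> borel_measurable (lebesgue_on \<Omega>)" "v \<in> borel_measurable (lebesgue_on \<Omega>)"
    using assms by (auto simp: L2_fun_def)
  have "integrable (lebesgue_on \<Omega>) (\<lambda>x. 2 * (u x)\<^sup>2 + 2 * (v x)\<^sup>2)"
    using assms by (auto simp: L2_fun_def)
  then have "integrable (lebesgue_on \<Omega>) (\<lambda>x. (u x + v x)\<^sup>2)"
  proof (rule Bochner_Integration.integrable_bound)
    have "(a + b)\<^sup>2 \<le> 2 * a\<^sup>2 + 2 * b\<^sup>2" for a b :: real
      using zero_le_power2[of "a - b"] by (simp add: power2_eq_square algebra_simps)
    then show "AE x in lebesgue_on \<Omega>. norm ((u x + v x)\<^sup>2) \<le> norm (2 * (u x)\<^sup>2 + 2 * (v x)\<^sup>2)"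
      by simp
  qed simp
  then show ?thesis by (auto simp: L2_fun_def)
qed

lemma L2_fun_diff:
  assumes "u \<in> L2_fun \<Omega>" "v \<in> L2_fun \<Omega>" shows "(\<lambda>x. u x - v x) \<in> L2_fun \<Omega>"
  using L2_fun_add[OF assms(1) L2_fun_scale[OF assms(2), of "-1"]] by simp

lemma L2_class_in_L2: "u \<in> L2_fun \<Omega> \<Longrightarrow> L2_class \<Omega> u \<in> L2 \<Omega>"
  by (simp add: L2_def L2_class_def quotientI)

lemma L2_cases:
  assumes "U \<in> L2 \<Omega>"
  obtains u where "u \<in> L2_fun \<Omega>" "U = L2_class \<Omega> u"
  using assms by (auto simp: L2_def L2_class_def elim: quotientE)

lemma L2_class_eq_iff:
  assumes "u \<in> L2_fun \<Omega>" "v \<in> L2_fun \<Omega>"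
  shows "L2_class \<Omega> u = L2_class \<Omega> v \<longleftrightarrow> (AE x in lebesgue_on \<Omega>. u x = v x)"
  using eq_equiv_class_iff[OF equiv_ae_rel assms] assms by (simp add: L2_class_def ae_rel_def)

lemma L2_add_class:
  assumes "u \<in> L2_fun \<Omega>" "v \<in> L2_fun \<Omega>"
  shows "L2_add \<Omega> (L2_class \<Omega> u) (L2_class \<Omega> v) = L2_class \<Omega> (\<lambda>x. u x + v x)"
proof -
  have "congruent2 (ae_rel \<Omega>) (ae_rel \<Omega>) (\<lambda>u v. L2_class \<Omega> (\<lambda>x. u x + v x))"
    by (rule congruent2I')
      (auto simp: ae_rel_def L2_class_eq_iff L2_fun_add elim: eventually_elim2)
  from UN_equiv_class2[OF equiv_ae_rel equiv_ae_rel this assms] show ?thesis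
    by (simp add: L2_add_def L2_class_def)
qed

lemma L2_diff_class:
  assumes "u \<in> L2_fun \<Omega>" "v \<in> L2_fun \<Omega>"
  shows "L2_diff \<Omega> (L2_class \<Omega> u) (L2_class \<Omega> v) = L2_class \<Omega> (\<lambda>x. u x - v x)"
proof -
  have "congruent2 (ae_rel \<Omega>) (ae_rel \<Omega>) (\<lambda>u v. L2_class \<Omega> (\<lambda>x. u x - v x))"
    by (rule congruent2I')
      (auto simp: ae_rel_def L2_class_eq_iff L2_fun_diff elim: eventually_elim2)
  from UN_equiv_class2[OF equiv_ae_rel equiv_ae_rel this assms] show ?thesis
    by (simp add: L2_diff_def L2_class_def)
qed

lemma L2_scale_class:
  assumes "u \<in> L2_fun \<Omega>"
  shows "L2_scale \<Omega> c (L2_class \<Omega> u) = L2_class \<Omega> (\<lambda>x. c * u x)"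
proof -
  have "congruent (ae_rel \<Omega>) (\<lambda>u. L2_class \<Omega> (\<lambda>x. c * u x))"
    by (rule congruentI)
      (auto simp: ae_rel_def L2_class_eq_iff L2_fun_scale elim: eventually_mono)
  from UN_equiv_class[OF equiv_ae_rel this assms] show ?thesis
    by (simp add: L2_scale_def L2_class_def)
qed

lemma L2_norm_class:
  assumes "u \<in> L2_fun \<Omega>"
  shows "L2_norm \<Omega> (L2_class \<Omega> u) = sqrt (LINT x|lebesgue_on \<Omega>. (u x)\<^sup>2)"
proof -
  have "(LINT x|lebesgue_on \<Omega>. (v x)\<^sup>2) = (LINT x|lebesgue_on \<Omega>. (u x)\<^sup>2)"
    if "v \<in> L2_class \<Omega> u" for v
    using that by (intro integral_cong_AE)
      (auto simp: L2_class_def ae_rel_def L2_fun_def elim: eventually_mono)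
  then have "(\<lambda>v. sqrt (LINT x|lebesgue_on \<Omega>. (v x)\<^sup>2)) ` L2_class \<Omega> u =
      (\<lambda>v. sqrt (LINT x|lebesgue_on \<Omega>. (u x)\<^sup>2)) ` L2_class \<Omega> u"
    by (intro image_cong arg_cong[where f = sqrt] refl)
  moreover have "L2_class \<Omega> u \<noteq> {}"
    using equiv_class_self[OF equiv_ae_rel assms] by (auto simp: L2_class_def)
  ultimately have "(\<lambda>v. sqrt (LINT x|lebesgue_on \<Omega>. (v x)\<^sup>2)) ` L2_class \<Omega> u =
      {sqrt (LINT x|lebesgue_on \<Omega>. (u x)\<^sup>2)}"
    by (simp add: image_constant_conv)
  then show ?thesis by (simp add: L2_norm_def)
qed

end

theory Submission
  imports Defs
begin

text \<open>
  The error \<open>u\<^sub>* - u\<^sub>N\<^sub>N\<close> is itself an element of \<open>L\<^sup>2(\<Omega>)\<close>, so the stability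
  estimate applies to it and bounds its norm by \<open>\<gamma>\<close> times the norm of its image under \<open>A\<close>.
  By linearity that image is \<open>A u\<^sub>* - A u\<^sub>N\<^sub>N = f - A u\<^sub>N\<^sub>N\<close>, which is the negative of the
  residual and so has the same norm. Linearity is given for sums and scalar multiples of
  classes, whereas the error is a difference; \<open>L2_diff_eq_add_scale\<close> links the two.
\<close>

lemma L2_scale_in_L2:
  assumes "U \<in> L2 \<Omega>"
  shows "L2_scale \<Omega> c U \<in> L2 \<Omega>"
  using assms by (elim L2_cases) (simp add: L2_scale_class L2_fun_scale L2_class_in_L2)

lemma L2_diff_in_L2:
  assumes "U \<in> L2 \<Omega>" "V \<in> L2 \<Omega>"
  shows "L2_diff \<Omega> U V \<in> L2 \<Omega>"
  using assms by (elim L2_cases) (simp add: L2_diff_class L2_fun_diff L2_class_in_L2)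

lemma L2_diff_eq_add_scale:
  assumes "U \<in> L2 \<Omega>" "V \<in> L2 \<Omega>"
  shows "L2_diff \<Omega> U V = L2_add \<Omega> U (L2_scale \<Omega> (-1) V)"
proof -
  obtain u where u: "u \<in> L2_fun \<Omega>" "U = L2_class \<Omega> u"
    using assms(1) by (rule L2_cases)
  obtain v where v: "v \<in> L2_fun \<Omega>" "V = L2_class \<Omega> v"
    using assms(2) by (rule L2_cases)
  have "L2_add \<Omega> U (L2_scale \<Omega> (-1) V) = L2_class \<Omega> (\<lambda>x. u x + (-1) * v x)"
    using u v by (simp only: L2_scale_class L2_add_class L2_fun_scale)
  also have "\<dots> = L2_diff \<Omega> U V"
    using u v by (simp add: L2_diff_class)
  finally show ?thesis ..
qed

lemma L2_bounded_linear_diff: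
  assumes A: "L2_bounded_linear \<Omega> A" and U: "U \<in> L2 \<Omega>" and V: "V \<in> L2 \<Omega>"
  shows "A (L2_diff \<Omega> U V) = L2_diff \<Omega> (A U) (A V)"
proof -
  have "A (L2_diff \<Omega> U V) = L2_add \<Omega> (A U) (A (L2_scale \<Omega> (-1) V))"
    using A U V by (simp add: L2_diff_eq_add_scale L2_scale_in_L2 L2_bounded_linear_def)
  also have "\<dots> = L2_add \<Omega> (A U) (L2_scale \<Omega> (-1) (A V))"
    using A V by (simp add: L2_bounded_linear_def)
  also have "\<dots> = L2_diff \<Omega> (A U) (A V)"
    using A U V by (simp add: L2_diff_eq_add_scale L2_bounded_linear_def)
  finally show ?thesis .
qed

lemma L2_norm_diff_commute:
  assumes "U \<in> L2 \<Omega>" "V \<in> L2 \<Omega>"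
  shows "L2_norm \<Omega> (L2_diff \<Omega> U V) = L2_norm \<Omega> (L2_diff \<Omega> V U)"
  using assms
  by (elim L2_cases) (simp add: L2_diff_class L2_fun_diff L2_norm_class power2_commute)

theorem theorem1:
  fixes \<Omega> :: "(real ^ 'd) set"
    and A :: "(real ^ 'd \<Rightarrow> real) set \<Rightarrow> (real ^ 'd \<Rightarrow> real) set"
    and f u_star u_NN :: "(real ^ 'd \<Rightarrow> real) set"
    and \<gamma> :: real
  assumes "open \<Omega>" and "connected \<Omega>" and "\<Omega> \<noteq> {}" and "bounded \<Omega>"
    and "L2_bounded_linear \<Omega> A"
    and "\<gamma> > 0"
    and "\<And>u. u \<in> L2 \<Omega> \<Longrightarrow> L2_norm \<Omega> u \<le> \<gamma> * L2_norm \<Omega> (A u)"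
    and "f \<in> L2 \<Omega>"
    and "u_star \<in> L2 \<Omega>" and "A u_star = f"
    and "u_NN \<in> L2 \<Omega>"
  shows "L2_norm \<Omega> (L2_diff \<Omega> u_star u_NN) \<le> \<gamma> * L2_norm \<Omega> (L2_diff \<Omega> (A u_NN) f)"
proof -
  have A_NN: "A u_NN \<in> L2 \<Omega>"
    using assms by (simp add: L2_bounded_linear_def)
  have "L2_norm \<Omega> (L2_diff \<Omega> u_star u_NN) \<le> \<gamma> * L2_norm \<Omega> (A (L2_diff \<Omega> u_star u_NN))"
    using assms by (simp add: L2_diff_in_L2)
  also have "A (L2_diff \<Omega> u_star u_NN) = L2_diff \<Omega> f (A u_NN)"
    using assms by (simp add: L2_bounded_linear_diff)
  also have "L2_norm \<Omega> (L2_diff \<Omega> f (A u_NN)) = L2_norm \<Omega> (L2_diff \<Omega> (A u_NN) f)"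
    using \<open>f \<in> L2 \<Omega>\<close> A_NN by (rule L2_norm_diff_commute)
  finally show ?thesis .
qed

end
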